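(* Let $n\geq 1$ be the fixed dimension and let $\kappa\in\mathbb{N}$, $\kappa\geq1$. For every $0<\varepsilon<1$ there is a positive constant $C(\kappa,\varepsilon)$, depending only on $\kappa$ and $\varepsilon$, and not on the operator norm $\mathfrak{N}_{T}(\sigma,\omega)$, such that whenever $\sigma$ and $\omega$ are locally finite positive Borel measures on $\mathbb{R}^{n}$ and $T$ is a bounded operator from $L^{2}(\sigma)$ to $L^{2}(\omega)$, $$\mathfrak{FT}_{T}^{(\kappa)}(\sigma,\omega)\leq C(\kappa,\varepsilon)\,\mathfrak{FT}_{T}(\sigma,\omega)+\varepsilon\,\mathfrak{N}_{T}(\sigma,\omega).$$
   Context: $T$ is linear; $T_{\sigma}:L^2(\sigma)\to L^2(\omega)$ denotes the action of $T$ on $L^2(\sigma)$ functions (for an integral operator, $T_\sigma f=T(f\sigma)$), and $\mathfrak{N}_{T}(\sigma,\omega)$ is its operator norm, i.e. the smallest constant with $\|T_\sigma f\|_{L^2(\omega)}\le\mathfrak{N}_T(\sigma,\omega)\|f\|_{L^2(\sigma)}$. $\mathcal{P}^{n}$ is the collection of all cubes in $\mathbb{R}^{n}$ with sides parallel to the coordinate axes; $c_Q$ and $\ell(Q)$ are the center and side length of $Q$, and $|Q|_\sigma=\sigma(Q)$. For a multiindex $\beta$, $m_{Q}^{\beta}(x)=\big(\frac{x-c_Q}{\ell(Q)}\big)^{\beta}$. The full $\kappa$-cube testing constant is given by $$\big(\mathfrak{FT}_{T}^{(\kappa)}(\sigma,\omega)\big)^{2}=\sup_{Q\in\mathcal{P}^{n}}\max_{0\leq|\beta|<\kappa}\frac{1}{|Q|_{\sigma}}\int_{\mathbb{R}^{n}}|T_{\sigma}(\mathbf{1}_{Q}m_{Q}^{\beta})|^{2}\,d\omega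 ,$$ the supremum being over cubes with $|Q|_\sigma>0$, and $\mathfrak{FT}_{T}=\mathfrak{FT}_{T}^{(1)}$ is the full testing constant over indicators of cubes, i.e. only $\mathbf{1}_Q$ is tested. *)

theory Defs
  imports "HOL-Analysis.Analysis"
begin

definition locally_finite_borel :: "'a::topological_space measure \<Rightarrow> bool" where
  "locally_finite_borel \<mu> \<longleftrightarrow>
     sets \<mu> = sets borel \<and> (\<forall>x. \<exists>U. open U \<and> x \<in> U \<and> emeasure \<mu> U < \<infinity>)"

definition ennreal_sqrt :: "ennreal \<Rightarrow> ennreal" where
  "ennreal_sqrt x = (if x = \<infinity> then \<infinity> else ennreal (sqrt (enn2real x)))"

lemma ennreal_sqrt_square: "ennreal_sqrt x ^ 2 = x"
  by (cases x) (auto simp: ennreal_sqrt_def ennreal_power power2_eq_square ennreal_mult[symmetric])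

text \<open>
  $L^2(\mu)$ is represented by functions rather than by classes modulo equality almost
  everywhere. The scalar type \<open>'k\<close> ranges over \<^class>\<open>real_normed_field\<close>, which covers both
  the real-valued and the complex-valued spaces.
\<close>

definition L2_space ::
    "'a measure \<Rightarrow> ('a \<Rightarrow> 'k::{real_normed_field, second_countable_topology}) set" where
  "L2_space \<mu> = {f \<in> borel_measurable \<mu>. (\<integral>\<^sup>+ x. ennreal ((norm (f x))\<^sup>2) \<partial>\<mu>) < \<infinity>}"

definition L2_norm ::
    "'a measure \<Rightarrow> ('a \<Rightarrow> 'k::{real_normed_field, second_countable_topology}) \<Rightarrow> ennreal" where
  "L2_norm \<mu> f = ennreal_sqrt (\<integral>\<^sup>+ x. ennreal ((norm (f x))\<^sup>2) \<partial>\<mu>)"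

text \<open>
  Identities between values of an operator hold almost everywhere. Independence of the chosen
  representative need not be required: if \<open>f = g\<close> almost everywhere, linearity and boundedness
  give \<open>T f = T g\<close> almost everywhere. Values of \<open>T\<close> outside \<^const>\<open>L2_space\<close> play no role.
\<close>

definition bounded_L2_operator ::
    "'a measure \<Rightarrow> 'b measure \<Rightarrow>
     (('a \<Rightarrow> 'k::{real_normed_field, second_countable_topology}) \<Rightarrow> ('b \<Rightarrow> 'k)) \<Rightarrow> bool" where
  "bounded_L2_operator \<sigma> \<omega> T \<longleftrightarrow>
     (\<forall>f \<in> L2_space \<sigma>. T f \<in> L2_space \<omega>) \<and>
     (\<forall>f \<in> L2_space \<sigma>. \<forall>g \<in> L2_space \<sigma>. AE x in \<omega>. T (\<lambda>y. f y + g y) x = T f x + T g x) \<and>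
     (\<forall>a. \<forall>f \<in> L2_space \<sigma>. AE x in \<omega>. T (\<lambda>y. a * f y) x = a * T f x) \<and>
     (\<exists>C::real. \<forall>f \<in> L2_space \<sigma>. L2_norm \<omega> (T f) \<le> ennreal C * L2_norm \<sigma> f)"

definition L2_operator_norm ::
    "'a measure \<Rightarrow> 'b measure \<Rightarrow>
     (('a \<Rightarrow> 'k::{real_normed_field, second_countable_topology}) \<Rightarrow> ('b \<Rightarrow> 'k)) \<Rightarrow> ennreal" where
  "L2_operator_norm \<sigma> \<omega> T =
     Inf {C. \<forall>f \<in> L2_space \<sigma>. L2_norm \<omega> (T f) \<le> C * L2_norm \<sigma> f}"

text \<open>
  Axis-parallel cubes are closed and are given by their centre \<open>c\<close> and side length \<open>l > 0\<close>.
\<close>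

definition cube :: "real ^ 'n \<Rightarrow> real \<Rightarrow> (real ^ 'n) set" where
  "cube c l = cbox (\<chi> i. c $ i - l / 2) (\<chi> i. c $ i + l / 2)"

definition multi_indices :: "nat \<Rightarrow> ('n::finite \<Rightarrow> nat) set" where
  "multi_indices \<kappa> = {\<beta>. (\<Sum>i\<in>UNIV. \<beta> i) < \<kappa>}"

definition cube_monomial :: "real ^ 'n \<Rightarrow> real \<Rightarrow> ('n \<Rightarrow> nat) \<Rightarrow> real ^ 'n \<Rightarrow> real" where
  "cube_monomial c l \<beta> x = (\<Prod>i\<in>UNIV. ((x $ i - c $ i) / l) ^ \<beta> i)"

text \<open>
  The supremum of the empty set is \<open>0\<close> in \<^typ>\<open>ennreal\<close>, so the testing constants vanish if
  no cube has positive \<open>\<sigma>\<close>-measure.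
\<close>

definition full_testing_poly ::
    "nat \<Rightarrow> (real ^ 'n) measure \<Rightarrow> (real ^ 'n) measure \<Rightarrow>
     ((real ^ 'n \<Rightarrow> 'k::{real_normed_field, second_countable_topology}) \<Rightarrow> (real ^ 'n \<Rightarrow> 'k)) \<Rightarrow>
     ennreal" where
  "full_testing_poly \<kappa> \<sigma> \<omega> T = ennreal_sqrt
     (SUP (c, l) \<in> {(c, l). l > 0 \<and> emeasure \<sigma> (cube c l) > 0}.
        MAX \<beta> \<in> multi_indices \<kappa>.
          (\<integral>\<^sup>+ x. ennreal ((norm
             (T (\<lambda>y. of_real (indicator (cube c l) y * cube_monomial c l \<beta> y)) x))\<^sup>2) \<partial>\<omega>)
          / emeasure \<sigma> (cube c l))"

definition full_testing ::
    "(real ^ 'n) measure \<Rightarrow> (real ^ 'n) measure \<Rightarrow>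
     ((real ^ 'n \<Rightarrow> 'k::{real_normed_field, second_countable_topology}) \<Rightarrow> (real ^ 'n \<Rightarrow> 'k)) \<Rightarrow>
     ennreal" where
  "full_testing \<sigma> \<omega> T = full_testing_poly 1 \<sigma> \<omega> T"

lemma finite_multi_indices: "finite (multi_indices \<kappa> :: ('n::finite \<Rightarrow> nat) set)"
proof (rule finite_subset)
  show "multi_indices \<kappa> \<subseteq> (PiE UNIV (\<lambda>_. {..<\<kappa>}) :: ('n \<Rightarrow> nat) set)"
  proof
    fix \<beta> :: "'n \<Rightarrow> nat" assume "\<beta> \<in> multi_indices \<kappa>"
    then have "(\<Sum>i\<in>UNIV. \<beta> i) < \<kappa>" by (simp add: multi_indices_def)
    moreover have "\<beta> i \<le> (\<Sum>i\<in>UNIV. \<beta> i)" for i by (rule member_le_sum) auto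
    ultimately show "\<beta> \<in> PiE UNIV (\<lambda>_. {..<\<kappa>})" by (auto intro: le_less_trans)
  qed
  show "finite (PiE UNIV (\<lambda>_. {..<\<kappa>}) :: ('n \<Rightarrow> nat) set)" by (intro finite_PiE) auto
qed

lemma full_testing_eq:
  fixes \<sigma> :: "(real ^ 'n) measure"
  shows "full_testing \<sigma> \<omega> T = ennreal_sqrt
     (SUP (c, l) \<in> {(c, l). l > 0 \<and> emeasure \<sigma> (cube c l) > 0}.
        (\<integral>\<^sup>+ x. ennreal ((norm (T (\<lambda>y. of_real (indicator (cube c l) y)) x))\<^sup>2) \<partial>\<omega>)
        / emeasure \<sigma> (cube c l))"
proof -
  have "multi_indices 1 = {\<lambda>_ :: 'n. 0}" by (auto simp: multi_indices_def)
  then show ?thesis by (simp add: full_testing_def full_testing_poly_def cube_monomial_def del: One_nat_def)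
qed

end

theory Submission
  imports Defs
begin

text \<open>
  Divide a cube \<open>Q\<close> into \<open>M ^ n\<close> cubes of side \<open>l / M\<close>, half open wherever they meet a neighbour, so
  that they are disjoint even if \<open>\<sigma>\<close> charges their faces. Replacing a monomial by its values at the
  centres of the pieces changes it by at most \<open>\<kappa> / M\<close> on \<open>Q\<close>, and this error is absorbed by
  \<open>\<epsilon>\<close> times the operator norm once \<open>M\<close> is large. The step function is a combination of indicators of
  the pieces with coefficients bounded by \<open>1\<close>. Each piece is a pointwise limit of closed cubes of the
  same side length, shifted slightly in the half-open directions, so by dominated convergence and
  boundedness of \<open>T\<close> it inherits the testing inequality. Working with squared norms and
  \<open>|x + y|\<^sup>2 \<le> 2|x|\<^sup>2 + 2|y|\<^sup>2\<close> avoids Minkowski's inequality at the price of constants only.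
\<close>

section \<open>Squared norms, square-integrable functions and local finiteness\<close>

definition sqn :: "'a measure \<Rightarrow> ('a \<Rightarrow> 'k::real_normed_vector) \<Rightarrow> ennreal" where
  "sqn \<mu> f = (\<integral>\<^sup>+ x. ennreal ((norm (f x))\<^sup>2) \<partial>\<mu>)"

lemma L2_norm_square: "(L2_norm \<mu> f)\<^sup>2 = sqn \<mu> f"
  by (simp add: L2_norm_def ennreal_sqrt_square sqn_def)

lemma mem_L2_space_iff: "f \<in> L2_space \<mu> \<longleftrightarrow> f \<in> borel_measurable \<mu> \<and> sqn \<mu> f < \<infinity>"
  by (simp add: L2_space_def sqn_def)

lemma sqn_cong_AE:
  assumes "AE x in \<mu>. f x = g x"
  shows "sqn \<mu> f = sqn \<mu> g"
  unfolding sqn_def by (rule nn_integral_cong_AE) (use assms in eventually_elim, simp)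

text \<open>Squaring is strictly increasing on extended nonnegative reals, because
  \<open>y < x\<close> already forces \<open>y\<close> to be finite. This allows the whole estimate
  to be carried out with squares and the square root to be taken only at the end.\<close>

lemma ennreal_le_of_square_le:
  fixes x y :: ennreal
  assumes "x\<^sup>2 \<le> y\<^sup>2"
  shows "x \<le> y"
proof (rule ccontr)
  assume "\<not> x \<le> y"
  then have "y < x" by simp
  then have "y * y < x * x"
    by (cases x; cases y) (auto simp: ennreal_mult_less_top ennreal_less_iff top_unique
        simp flip: ennreal_mult intro!: mult_strict_mono)
  with assms show False by (simp add: power2_eq_square)
qed

lemma ennreal_sqrt_le: "x \<le> y\<^sup>2 \<Longrightarrow> ennreal_sqrt x \<le> y"
  by (rule ennreal_le_of_square_le) (simp add: ennreal_sqrt_square)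

text \<open>The missing cross terms are nonnegative. This direction recombines two squared bounds
  into the square of a sum without losing a constant, so \<open>\<epsilon>\<close> survives
  unchanged in the final estimate.\<close>

lemma square_add_le:
  fixes x y :: ennreal
  shows "x\<^sup>2 + y\<^sup>2 \<le> (x + y)\<^sup>2"
  by (simp add: power2_eq_square algebra_simps add_left_mono le_iff_add)

lemma norm_add_square_le:
  fixes x y :: "'k::real_normed_vector"
  shows "(norm (x + y))\<^sup>2 \<le> 2 * (norm x)\<^sup>2 + 2 * (norm y)\<^sup>2"
proof -
  have "(norm (x + y))\<^sup>2 \<le> (norm x + norm y)\<^sup>2"
    by (intro power_mono norm_triangle_ineq) auto
  also have "\<dots> \<le> 2 * (norm x)\<^sup>2 + 2 * (norm y)\<^sup>2"
    using zero_le_power2[of "norm x - norm y"] by (simp add: power2_eq_square algebra_simps)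
  finally show ?thesis .
qed

lemma sqn_add_le:
  assumes "f \<in> L2_space \<mu>" "g \<in> L2_space \<mu>"
  shows "sqn \<mu> (\<lambda>x. f x + g x) \<le> 2 * sqn \<mu> f + 2 * sqn \<mu> g"
proof -
  have [measurable]: "f \<in> borel_measurable \<mu>" "g \<in> borel_measurable \<mu>"
    using assms by (auto simp: mem_L2_space_iff)
  have "sqn \<mu> (\<lambda>x. f x + g x)
      \<le> (\<integral>\<^sup>+ x. 2 * ennreal ((norm (f x))\<^sup>2) + 2 * ennreal ((norm (g x))\<^sup>2) \<partial>\<mu>)"
    unfolding sqn_def
  proof (rule nn_integral_mono)
    fix x
    have "ennreal ((norm (f x + g x))\<^sup>2) \<le> ennreal (2 * (norm (f x))\<^sup>2 + 2 * (norm (g x))\<^sup>2)"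
      by (intro ennreal_leI norm_add_square_le)
    also have "\<dots> = 2 * ennreal ((norm (f x))\<^sup>2) + 2 * ennreal ((norm (g x))\<^sup>2)"
      by (simp add: ennreal_plus ennreal_mult)
    finally show "ennreal ((norm (f x + g x))\<^sup>2) \<le> \<dots>" .
  qed
  also have "\<dots> = 2 * sqn \<mu> f + 2 * sqn \<mu> g"
    by (simp add: sqn_def nn_integral_add nn_integral_cmult)
  finally show ?thesis .
qed

lemma sqn_cmult:
  fixes f :: "'a \<Rightarrow> 'k::{real_normed_field, second_countable_topology}"
  assumes "f \<in> L2_space \<mu>"
  shows "sqn \<mu> (\<lambda>x. a * f x) = ennreal ((norm a)\<^sup>2) * sqn \<mu> f"
proof -
  have [measurable]: "f \<in> borel_measurable \<mu>"
    using assms by (auto simp: mem_L2_space_iff)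
  show ?thesis
    by (simp add: sqn_def norm_mult power_mult_distrib ennreal_mult nn_integral_cmult)
qed

lemma L2_space_add:
  "f \<in> L2_space \<mu> \<Longrightarrow> g \<in> L2_space \<mu> \<Longrightarrow> (\<lambda>x. f x + g x) \<in> L2_space \<mu>"
  using sqn_add_le[of f \<mu> g]
  by (auto simp: mem_L2_space_iff ennreal_mult_less_top intro: le_less_trans)

lemma L2_space_cmult: "f \<in> L2_space \<mu> \<Longrightarrow> (\<lambda>x. a * f x) \<in> L2_space \<mu>"
  using sqn_cmult[of f \<mu> a]
  by (auto simp: mem_L2_space_iff ennreal_mult_less_top)

lemma L2_space_sum:
  assumes "finite J" "\<And>j. j \<in> J \<Longrightarrow> f j \<in> L2_space \<mu>"
  shows "(\<lambda>x. \<Sum>j\<in>J. f j x) \<in> L2_space \<mu>"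
  using assms
proof (induction rule: finite_induct)
  case empty
  show ?case by (simp add: mem_L2_space_iff sqn_def)
next
  case (insert j J)
  then show ?case using L2_space_add[of "f j" \<mu> "\<lambda>x. \<Sum>j\<in>J. f j x"] by simp
qed

text \<open>The basic size estimate for test functions: a finite right-hand side gives membership in
  L2, and a small \<open>B\<close> or a small measure of \<open>A\<close> makes an approximation
  error small.\<close>

lemma sqn_supported_le:
  assumes "A \<in> sets \<mu>" and "\<And>x. norm (f x) \<le> B * indicator A x"
  shows "sqn \<mu> f \<le> ennreal (B\<^sup>2) * emeasure \<mu> A"
proof -
  have "sqn \<mu> f \<le> (\<integral>\<^sup>+ x. ennreal (B\<^sup>2) * indicator A x \<partial>\<mu>)"
    unfolding sqn_def
  proof (rule nn_integral_mono)
    fix x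
    have "(norm (f x))\<^sup>2 \<le> (B * indicator A x)\<^sup>2"
      using assms(2) by (intro power_mono) auto
    then show "ennreal ((norm (f x))\<^sup>2) \<le> ennreal (B\<^sup>2) * indicator A x"
      by (auto simp: indicator_def ennreal_leI)
  qed
  also have "\<dots> = ennreal (B\<^sup>2) * emeasure \<mu> A"
    using assms(1) by (simp add: nn_integral_cmult)
  finally show ?thesis .
qed

lemma L2_space_supported:
  assumes "f \<in> borel_measurable \<mu>" "A \<in> sets \<mu>" "emeasure \<mu> A < \<infinity>"
    and "\<And>x. norm (f x) \<le> B * indicator A x"
  shows "f \<in> L2_space \<mu>"
proof -
  have "sqn \<mu> f \<le> ennreal (B\<^sup>2) * emeasure \<mu> A"
    using assms by (intro sqn_supported_le)
  also have "\<dots> < \<infinity>"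
    using assms by (simp add: ennreal_mult_less_top)
  finally show ?thesis using assms by (simp add: mem_L2_space_iff)
qed

text \<open>Finitely many open sets of finite measure cover a compact set. Closed cubes therefore
  have finite measure, and bounded Borel functions supported in them are square integrable.\<close>

lemma locally_finite_borel_compact:
  assumes "locally_finite_borel \<mu>" "compact K"
  shows "emeasure \<mu> K < \<infinity>"
proof -
  obtain U where U: "\<And>x. open (U x)" "\<And>x. x \<in> U x" "\<And>x. emeasure \<mu> (U x) < \<infinity>"
    using assms(1) unfolding locally_finite_borel_def by metis
  obtain D where D: "finite D" "K \<subseteq> (\<Union>x\<in>D. U x)"
    using compactE_image[OF assms(2), of UNIV U] U by (metis UNIV_I UN_iff subsetI)
  have s: "U x \<in> sets \<mu>" for x
    using assms(1) U(1) by (simp add: locally_finite_borel_def)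
  have "emeasure \<mu> K \<le> emeasure \<mu> (\<Union>x\<in>D. U x)"
    using D s by (intro emeasure_mono) auto
  also have "\<dots> \<le> (\<Sum>x\<in>D. emeasure \<mu> (U x))"
    using D s by (intro emeasure_subadditive_finite) auto
  also have "\<dots> < \<infinity>" using D U by simp
  finally show ?thesis .
qed

section \<open>Linear operators bounded on L2\<close>

locale L2_operator =
  fixes \<sigma> :: "'a measure" and \<omega> :: "'b measure"
    and T :: "('a \<Rightarrow> 'k::{real_normed_field, second_countable_topology}) \<Rightarrow> 'b \<Rightarrow> 'k"
  assumes bounded: "bounded_L2_operator \<sigma> \<omega> T"
begin

abbreviation opnorm :: ennreal where
  "opnorm \<equiv> L2_operator_norm \<sigma> \<omega> T"

lemma T_L2 [intro]: "f \<in> L2_space \<sigma> \<Longrightarrow> T f \<in> L2_space \<omega>"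
  using bounded by (simp add: bounded_L2_operator_def)

lemma T_add: "f \<in> L2_space \<sigma> \<Longrightarrow> g \<in> L2_space \<sigma> \<Longrightarrow> AE x in \<omega>. T (\<lambda>y. f y + g y) x = T f x + T g x"
  using bounded by (simp add: bounded_L2_operator_def)

lemma T_cmult: "f \<in> L2_space \<sigma> \<Longrightarrow> AE x in \<omega>. T (\<lambda>y. a * f y) x = a * T f x"
  using bounded by (simp add: bounded_L2_operator_def)

text \<open>Homogeneity with scalar \<open>0\<close>. Linearity holds only almost everywhere, so the
  image of zero is zero only in that sense; this is the empty case of \<open>T_sum\<close>.\<close>

lemma T_zero: "AE x in \<omega>. T (\<lambda>y. 0) x = 0"
  using T_cmult[of "\<lambda>y. 0" 0] by (simp add: mem_L2_space_iff sqn_def)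

lemma T_sum:
  assumes "finite J" "\<And>j. j \<in> J \<Longrightarrow> f j \<in> L2_space \<sigma>"
  shows "AE x in \<omega>. T (\<lambda>y. \<Sum>j\<in>J. a j * f j y) x = (\<Sum>j\<in>J. a j * T (f j) x)"
  using assms
proof (induction rule: finite_induct)
  case empty
  show ?case using T_zero by simp
next
  case (insert j J)
  have "AE x in \<omega>. T (\<lambda>y. a j * f j y + (\<Sum>j\<in>J. a j * f j y)) x
      = T (\<lambda>y. a j * f j y) x + T (\<lambda>y. \<Sum>j\<in>J. a j * f j y) x"
    using insert by (intro T_add L2_space_cmult L2_space_sum) auto
  moreover have "AE x in \<omega>. T (\<lambda>y. a j * f j y) x = a j * T (f j) x"
    using insert by (intro T_cmult) auto
  moreover have "AE x in \<omega>. T (\<lambda>y. \<Sum>j\<in>J. a j * f j y) x = (\<Sum>j\<in>J. a j * T (f j) x)"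
    using insert by auto
  ultimately show ?case
    by eventually_elim (use insert in simp)
qed

text \<open>Any admissible real constant lies above the infimum. Finiteness matters when the norm
  multiplies a measure that tends to zero.\<close>

lemma opnorm_finite: "opnorm < \<infinity>"
proof -
  obtain C :: real where "\<forall>f \<in> L2_space \<sigma>. L2_norm \<omega> (T f) \<le> ennreal C * L2_norm \<sigma> f"
    using bounded by (auto simp: bounded_L2_operator_def)
  then have "opnorm \<le> ennreal C"
    unfolding L2_operator_norm_def by (intro Inf_lower) auto
  then show ?thesis by (simp add: le_less_trans[OF _ ennreal_less_top])
qed

text \<open>The infimum defining the norm is itself admissible: for \<open>f\<close> of nonzero
  norm, the quotient of the two norms is a lower bound for all admissible constants.\<close>

lemma L2_norm_T_le:
  assumes f: "f \<in> L2_space \<sigma>"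
  shows "L2_norm \<omega> (T f) \<le> opnorm * L2_norm \<sigma> f"
proof -
  obtain C :: real where C: "\<forall>f \<in> L2_space \<sigma>. L2_norm \<omega> (T f) \<le> ennreal C * L2_norm \<sigma> f"
    using bounded by (auto simp: bounded_L2_operator_def)
  have fin: "L2_norm \<sigma> f < \<infinity>"
    using f by (auto simp: L2_norm_def ennreal_sqrt_def L2_space_def)
  show ?thesis
  \<comment> \<open>The quotient is useless when the norm of \<open>f\<close> is zero; there the
    finite constant \<open>C\<close> forces the norm of \<open>T f\<close> to vanish.\<close>
  proof (cases "L2_norm \<sigma> f = 0")
    case True
    then show ?thesis using C f by (metis mult_zero_right)
  next
    case False
    have "L2_norm \<omega> (T f) / L2_norm \<sigma> f \<le> opnorm"
      unfolding L2_operator_norm_def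
    proof (rule Inf_greatest, clarify)
      fix D assume "\<forall>f\<in>L2_space \<sigma>. L2_norm \<omega> (T f) \<le> D * L2_norm \<sigma> f"
      then show "L2_norm \<omega> (T f) / L2_norm \<sigma> f \<le> D"
        using f False by (intro divide_le_posI_ennreal) (auto simp: mult.commute zero_less_iff_neq_zero)
    qed
    then have "L2_norm \<omega> (T f) / L2_norm \<sigma> f * L2_norm \<sigma> f \<le> opnorm * L2_norm \<sigma> f"
      by (rule mult_right_mono) simp
    then show ?thesis
      using False fin
      by (simp add: ennreal_divide_times ennreal_divide_self less_top)
  qed
qed

lemma sqn_T_le:
  assumes "f \<in> L2_space \<sigma>"
  shows "sqn \<omega> (T f) \<le> opnorm\<^sup>2 * sqn \<sigma> f"
proof -
  have "(L2_norm \<omega> (T f))\<^sup>2 \<le> (opnorm * L2_norm \<sigma> f)\<^sup>2"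
    by (intro power_mono L2_norm_T_le assms) simp
  then show ?thesis by (simp add: L2_norm_square power_mult_distrib)
qed

lemma sqn_T_add_le:
  assumes "f \<in> L2_space \<sigma>" "g \<in> L2_space \<sigma>"
  shows "sqn \<omega> (T (\<lambda>y. f y + g y)) \<le> 2 * sqn \<omega> (T f) + 2 * sqn \<omega> (T g)"
  using sqn_add_le[OF T_L2[OF assms(1)] T_L2[OF assms(2)]] sqn_cong_AE[OF T_add[OF assms]] by simp

text \<open>After linearity and the bound on the coefficients, this is the Cauchy-Schwarz inequality
  for a finite sum, applied pointwise and integrated. The loss \<open>card J\<close> is harmless
  because the number of pieces is fixed before the measures and the operator.\<close>

lemma sqn_T_sum_le:
  assumes J: "finite J" and f: "\<And>j. j \<in> J \<Longrightarrow> f j \<in> L2_space \<sigma>"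
    and a: "\<And>j. j \<in> J \<Longrightarrow> norm (a j) \<le> 1"
  shows "sqn \<omega> (T (\<lambda>y. \<Sum>j\<in>J. a j * f j y)) \<le> of_nat (card J) * (\<Sum>j\<in>J. sqn \<omega> (T (f j)))"
proof -
  have m: "T (f j) \<in> borel_measurable \<omega>" if "j \<in> J" for j
    using T_L2[OF f[OF that]] by (simp add: mem_L2_space_iff)
  have "sqn \<omega> (T (\<lambda>y. \<Sum>j\<in>J. a j * f j y)) = sqn \<omega> (\<lambda>x. \<Sum>j\<in>J. a j * T (f j) x)"
    by (intro sqn_cong_AE T_sum J f)
  also have "\<dots> \<le> (\<integral>\<^sup>+ x. of_nat (card J) * (\<Sum>j\<in>J. ennreal ((norm (T (f j) x))\<^sup>2)) \<partial>\<omega>)"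
    unfolding sqn_def
  proof (rule nn_integral_mono)
    fix x
    have "norm (\<Sum>j\<in>J. a j * T (f j) x) \<le> (\<Sum>j\<in>J. norm (T (f j) x))"
      using a by (intro sum_norm_le) (auto simp: norm_mult intro: mult_left_le_one_le)
    then have "(norm (\<Sum>j\<in>J. a j * T (f j) x))\<^sup>2 \<le> (\<Sum>j\<in>J. norm (T (f j) x))\<^sup>2"
      by (intro power_mono) auto
    also have "\<dots> \<le> (\<Sum>j\<in>J. (norm (T (f j) x))\<^sup>2) * card J"
      by (rule sum_squared_le_sum_of_squares)
    finally have "ennreal ((norm (\<Sum>j\<in>J. a j * T (f j) x))\<^sup>2)
        \<le> ennreal (real (card J) * (\<Sum>j\<in>J. (norm (T (f j) x))\<^sup>2))"
      by (intro ennreal_leI) (simp add: mult.commute)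
    also have "\<dots> = of_nat (card J) * (\<Sum>j\<in>J. ennreal ((norm (T (f j) x))\<^sup>2))"
      by (simp add: ennreal_mult sum_nonneg ennreal_of_nat_eq_real_of_nat flip: sum_ennreal)
    finally show "ennreal ((norm (\<Sum>j\<in>J. a j * T (f j) x))\<^sup>2) \<le> \<dots>" .
  qed
  also have "\<dots> = of_nat (card J) * (\<Sum>j\<in>J. sqn \<omega> (T (f j)))"
    using m by (simp add: sqn_def nn_integral_cmult nn_integral_sum del: sum_ennreal)
  finally show ?thesis .
qed

end

section \<open>Half-open cubes as limits of closed cubes\<close>

lemma mem_cube_iff: "x \<in> cube c l \<longleftrightarrow> (\<forall>i. c $ i - l / 2 \<le> x $ i \<and> x $ i \<le> c $ i + l / 2)"
  by (simp add: cube_def mem_box_cart)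

text \<open>Making \<open>S\<close> a parameter lets each grid piece lose its upper face exactly in
  the directions where another piece follows.\<close>

definition half_open_cube :: "real ^ 'n \<Rightarrow> real \<Rightarrow> 'n set \<Rightarrow> (real ^ 'n) set" where
  "half_open_cube c l S = {x. \<forall>i. c $ i - l / 2 \<le> x $ i \<and>
     (if i \<in> S then x $ i < c $ i + l / 2 else x $ i \<le> c $ i + l / 2)}"

lemma half_open_cube_borel [measurable]: "half_open_cube c l S \<in> sets borel"
  unfolding half_open_cube_def
proof (rule pred_Collect_borel)
  show "Measurable.pred borel (\<lambda>x. \<forall>i. c $ i - l / 2 \<le> x $ i \<and>
      (if i \<in> S then x $ i < c $ i + l / 2 else x $ i \<le> c $ i + l / 2))"
    by measurable
qed

lemma half_open_cube_subset: "half_open_cube c l S \<subseteq> cube c l"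
proof
  fix x assume x: "x \<in> half_open_cube c l S"
  show "x \<in> cube c l"
    unfolding mem_cube_iff
  proof
    fix i
    show "c $ i - l / 2 \<le> x $ i \<and> x $ i \<le> c $ i + l / 2"
      using x[unfolded half_open_cube_def mem_Collect_eq, rule_format, of i]
      by (auto split: if_splits)
  qed
qed

text \<open>The shift goes downwards: it expels the upper face at once and keeps the lower one,
  while the extra points below the lower face drop out in the limit.\<close>

definition shifted_center :: "real ^ 'n \<Rightarrow> real \<Rightarrow> 'n set \<Rightarrow> nat \<Rightarrow> real ^ 'n" where
  "shifted_center c l S k = (\<chi> i. c $ i - (if i \<in> S then l * inverse (real (Suc k)) else 0))"

text \<open>This is pointwise convergence of the indicators, proved coordinate by coordinate;
  finitely many eventual statements then hold simultaneously.\<close>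

lemma eventually_mem_shifted_cube:
  assumes "l > 0"
  shows "\<forall>\<^sub>F k in sequentially. x \<in> cube (shifted_center c l S k) l \<longleftrightarrow> x \<in> half_open_cube c l S"
proof -
  have lim: "(\<lambda>k. l * inverse (real (Suc k))) \<longlonglongrightarrow> 0"
    using tendsto_mult_left[OF LIMSEQ_inverse_real_of_nat, of l] by simp
  have "\<forall>\<^sub>F k in sequentially.
      (shifted_center c l S k $ i - l / 2 \<le> x $ i \<and> x $ i \<le> shifted_center c l S k $ i + l / 2) \<longleftrightarrow>
      (c $ i - l / 2 \<le> x $ i \<and> (if i \<in> S then x $ i < c $ i + l / 2 else x $ i \<le> c $ i + l / 2))" for i
  proof (cases "i \<in> S")
    case True
    have pos: "l * inverse (real (Suc k)) > 0" for k using assms by simp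
    \<comment> \<open>Below the lower face, \<open>x\<close> is excluded once the shift is smaller
      than its distance to that face. Inside, it is included once the shift is smaller than its
      distance to the upper face. On or beyond the upper face it is excluded for every
      \<open>k\<close>.\<close>
    consider "x $ i < c $ i - l / 2" | "c $ i - l / 2 \<le> x $ i" "x $ i < c $ i + l / 2" | "c $ i + l / 2 \<le> x $ i"
      by linarith
    then show ?thesis
    proof cases
      case 1
      then have "\<forall>\<^sub>F k in sequentially. l * inverse (real (Suc k)) < c $ i - l / 2 - x $ i"
        by (intro order_tendstoD(2)[OF lim]) simp
      then show ?thesis
        by eventually_elim (use 1 True in \<open>auto simp: shifted_center_def\<close>)
    next
      case 2
      then have "\<forall>\<^sub>F k in sequentially. l * inverse (real (Suc k)) < c $ i + l / 2 - x $ i"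
        by (intro order_tendstoD(2)[OF lim]) simp
      then show ?thesis
      proof eventually_elim
        case (elim k)
        then show ?case using 2 True pos[of k] by (simp add: shifted_center_def del: of_nat_Suc)
      qed
    next
      case 3
      then show ?thesis
      proof (intro always_eventually allI)
        fix k
        show "(shifted_center c l S k $ i - l / 2 \<le> x $ i \<and> x $ i \<le> shifted_center c l S k $ i + l / 2) \<longleftrightarrow>
          (c $ i - l / 2 \<le> x $ i \<and> (if i \<in> S then x $ i < c $ i + l / 2 else x $ i \<le> c $ i + l / 2))"
          using 3 True pos[of k] by (simp add: shifted_center_def del: of_nat_Suc)
      qed
    qed
  qed (simp add: shifted_center_def)
  then have "\<forall>\<^sub>F k in sequentially. \<forall>i.
      (shifted_center c l S k $ i - l / 2 \<le> x $ i \<and> x $ i \<le> shifted_center c l S k $ i + l / 2) \<longleftrightarrow>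
      (c $ i - l / 2 \<le> x $ i \<and> (if i \<in> S then x $ i < c $ i + l / 2 else x $ i \<le> c $ i + l / 2))"
    by (rule eventually_all_finite)
  then show ?thesis
    by eventually_elim (simp only: mem_cube_iff half_open_cube_def mem_Collect_eq)
qed

text \<open>The largest shift is \<open>l\<close>, at \<open>k = 0\<close>, whence the factor 3. The
  tripled cube is a common set of finite measure that serves as the dominating function.\<close>

lemma shifted_cube_subset:
  assumes "l > 0"
  shows "cube (shifted_center c l S k) l \<subseteq> cube c (3 * l)"
proof
  fix x assume x: "x \<in> cube (shifted_center c l S k) l"
  have "l * inverse (real (Suc k)) \<le> l * 1"
    using assms by (intro mult_left_mono) (auto simp: field_simps)
  moreover have "l * inverse (real (Suc k)) \<ge> 0" using assms by simp
  ultimately have *: "\<bar>shifted_center c l S k $ i - c $ i\<bar> \<le> l" for i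
    using assms by (simp add: shifted_center_def)
  show "x \<in> cube c (3 * l)"
    unfolding mem_cube_iff
  proof
    fix i
    show "c $ i - 3 * l / 2 \<le> x $ i \<and> x $ i \<le> c $ i + 3 * l / 2"
      using x[unfolded mem_cube_iff, rule_format, of i] *[of i] by (simp add: abs_le_iff)
  qed
qed

section \<open>Testing on half-open cubes\<close>

lemma cube_borel [measurable]: "cube c l \<in> sets borel"
  by (simp add: cube_def)

text \<open>\<open>F\<close> stands for the square of the testing constant. The testing inequality
  is stated without division, so it also covers cubes of measure zero.\<close>

locale L2_operator_cart = L2_operator \<sigma> \<omega> T
  for \<sigma> \<omega> :: "(real ^ 'n) measure"
    and T :: "(real ^ 'n \<Rightarrow> 'k::{real_normed_field, second_countable_topology}) \<Rightarrow> real ^ 'n \<Rightarrow> 'k" +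
  fixes F :: ennreal
  assumes lf: "locally_finite_borel \<sigma>"
    and F_finite: "F < \<infinity>"
    and testing: "\<And>c l. l > 0 \<Longrightarrow>
      sqn \<omega> (T (\<lambda>y. of_real (indicator (cube c l) y))) \<le> F * emeasure \<sigma> (cube c l)"
begin

lemma sets_eq [measurable_cong]: "sets \<sigma> = sets borel"
  using lf by (simp add: locally_finite_borel_def)

lemma cube_finite: "emeasure \<sigma> (cube c l) < \<infinity>"
  using lf by (intro locally_finite_borel_compact) (simp_all add: cube_def)

lemma L2_cube_supported:
  fixes f :: "real ^ 'n \<Rightarrow> 'k"
  assumes "f \<in> borel_measurable borel" "\<And>x. norm (f x) \<le> B * indicator (cube c l) x"
  shows "f \<in> L2_space \<sigma>"
  using assms cube_finite by (intro L2_space_supported[of f \<sigma> "cube c l" B])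
    (auto simp: sets_eq measurable_cong_sets[OF sets_eq refl])

lemma L2_indicator:
  assumes "A \<in> sets borel" "A \<subseteq> cube c l"
  shows "(\<lambda>y. of_real (indicator A y) :: 'k) \<in> L2_space \<sigma>"
proof (rule L2_cube_supported)
  show "(\<lambda>y. of_real (indicator A y) :: 'k) \<in> borel_measurable borel"
    using assms(1) by measurable
  show "norm (of_real (indicator A x) :: 'k) \<le> 1 * indicator (cube c l) x" for x
    using assms(2) by (auto simp: indicator_def)
qed

text \<open>The right-hand side must carry the measure of the half-open cube itself: closed pieces
  would count shared faces repeatedly when summed. The factor 2 comes from splitting off the error
  before passing to the limit.\<close>

lemma testing_half_open:
  assumes l: "l > 0"
  shows "sqn \<omega> (T (\<lambda>y. of_real (indicator (half_open_cube c l S) y)))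
    \<le> 2 * F * emeasure \<sigma> (half_open_cube c l S)"
proof -
  define P where "P = half_open_cube c l S"
  define A where "A k = cube (shifted_center c l S k) l" for k
  \<comment> \<open>The symmetric difference, which is exactly where the two indicators
    differ.\<close>
  define D where "D k = (P - A k) \<union> (A k - P)" for k
  have AQ: "A k \<subseteq> cube c (3 * l)" for k
    using shifted_cube_subset[OF l] by (simp add: A_def)
  \<comment> \<open>For empty \<open>S\<close> nothing is shifted, so the containment of shifted
    cubes specializes to this one.\<close>
  have "cube c l \<subseteq> cube c (3 * l)"
    using shifted_cube_subset[OF l, of c "{}"] by (simp add: shifted_center_def)
  then have PQ: "P \<subseteq> cube c (3 * l)"
    using half_open_cube_subset[of c l S] by (auto simp: P_def)
  have [measurable]: "P \<in> sets borel" "A k \<in> sets borel" "D k \<in> sets borel" for k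
    by (auto simp: P_def A_def D_def)
  have D0: "(\<lambda>k. emeasure \<sigma> (D k)) \<longlonglongrightarrow> 0"
  proof -
    have "(\<lambda>k. \<integral>\<^sup>+ x. indicator (D k) x \<partial>\<sigma>) \<longlonglongrightarrow> (\<integral>\<^sup>+ x. 0 \<partial>\<sigma>)"
    proof (rule nn_integral_dominated_convergence)
      show "AE x in \<sigma>. indicator (D k) x \<le> (indicator (cube c (3 * l)) x :: ennreal)" for k
        using PQ AQ[of k] by (auto simp: D_def indicator_def)
      show "(\<integral>\<^sup>+ x. indicator (cube c (3 * l)) x \<partial>\<sigma>) < \<infinity>"
        using cube_finite by (simp add: sets_eq)
      show "AE x in \<sigma>. (\<lambda>k. indicator (D k) x :: ennreal) \<longlonglongrightarrow> 0"
      proof (intro AE_I2 tendsto_eventually)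
        fix x
        show "\<forall>\<^sub>F k in sequentially. (indicator (D k) x :: ennreal) = 0"
          using eventually_mem_shifted_cube[OF l, of x c S]
          by eventually_elim (auto simp: D_def A_def P_def)
      qed
    qed measurable
    then show ?thesis by (simp add: sets_eq)
  qed
  \<comment> \<open>The operator norm multiplies only the measure of \<open>D k\<close>, so it
    disappears from the estimate as \<open>k\<close> grows.\<close>
  have bound: "sqn \<omega> (T (\<lambda>y. of_real (indicator P y)))
      \<le> 2 * F * emeasure \<sigma> P + (2 * F + 2 * opnorm\<^sup>2) * emeasure \<sigma> (D k)" for k
  proof -
    define d :: "real ^ 'n \<Rightarrow> 'k" where "d y = of_real (indicator P y - indicator (A k) y)" for y
    have dL: "d \<in> L2_space \<sigma>"
    proof (rule L2_cube_supported)
      show "norm (d x) \<le> 1 * indicator (cube c (3 * l)) x" for x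
        using PQ AQ[of k] by (auto simp: d_def indicator_def)
    qed (unfold d_def, measurable)
    have AL: "(\<lambda>y. of_real (indicator (A k) y) :: 'k) \<in> L2_space \<sigma>"
      by (rule L2_indicator[OF _ AQ]) measurable
    have "sqn \<omega> (T (\<lambda>y. of_real (indicator P y)))
        = sqn \<omega> (T (\<lambda>y. of_real (indicator (A k) y) + d y))"
      by (simp add: d_def)
    also have "\<dots> \<le> 2 * sqn \<omega> (T (\<lambda>y. of_real (indicator (A k) y))) + 2 * sqn \<omega> (T d)"
      by (rule sqn_T_add_le[OF AL dL])
    also have "\<dots> \<le> 2 * (F * emeasure \<sigma> (A k)) + 2 * (opnorm\<^sup>2 * (1 * emeasure \<sigma> (D k)))"
    proof (intro add_mono mult_left_mono)
      show "sqn \<omega> (T (\<lambda>y. of_real (indicator (A k) y))) \<le> F * emeasure \<sigma> (A k)"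
        unfolding A_def by (rule testing[OF l])
      have "sqn \<sigma> d \<le> ennreal (1\<^sup>2) * emeasure \<sigma> (D k)"
        by (intro sqn_supported_le) (auto simp: sets_eq d_def D_def indicator_def)
      then have "opnorm\<^sup>2 * sqn \<sigma> d \<le> opnorm\<^sup>2 * (1 * emeasure \<sigma> (D k))"
        by (intro mult_left_mono) auto
      with sqn_T_le[OF dL] show "sqn \<omega> (T d) \<le> opnorm\<^sup>2 * (1 * emeasure \<sigma> (D k))"
        by (rule order_trans)
    qed auto
    also have "\<dots> \<le> 2 * (F * (emeasure \<sigma> P + emeasure \<sigma> (D k))) + 2 * (opnorm\<^sup>2 * (1 * emeasure \<sigma> (D k)))"
    proof (intro add_mono mult_left_mono order_refl)
      have "emeasure \<sigma> (A k) \<le> emeasure \<sigma> (P \<union> D k)"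
        by (intro emeasure_mono) (auto simp: D_def sets_eq)
      also have "\<dots> \<le> emeasure \<sigma> P + emeasure \<sigma> (D k)"
        by (intro emeasure_subadditive) (auto simp: sets_eq)
      finally show "emeasure \<sigma> (A k) \<le> \<dots>" .
    qed auto
    finally show ?thesis by (simp add: algebra_simps)
  qed
  \<comment> \<open>The coefficient of the vanishing measure is finite because both \<open>F\<close>
    and the operator norm are.\<close>
  have "(\<lambda>k. 2 * F * emeasure \<sigma> P + (2 * F + 2 * opnorm\<^sup>2) * emeasure \<sigma> (D k))
      \<longlonglongrightarrow> 2 * F * emeasure \<sigma> P + (2 * F + 2 * opnorm\<^sup>2) * 0"
    using F_finite opnorm_finite
    by (intro tendsto_add tendsto_const ennreal_tendsto_cmult D0)
      (auto simp: ennreal_mult_less_top power2_eq_square)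
  then have "sqn \<omega> (T (\<lambda>y. of_real (indicator P y))) \<le> 2 * F * emeasure \<sigma> P + (2 * F + 2 * opnorm\<^sup>2) * 0"
    by (rule tendsto_lowerbound) (use bound in auto)
  then show ?thesis by (simp add: P_def)
qed

end

section \<open>Subdivision of a cube into a grid\<close>

lemma grid_index_exists:
  fixes a h t :: real and M :: nat
  assumes "M > 0" "h > 0" "a \<le> t" "t \<le> a + M * h"
  shows "\<exists>j<M. a + real j * h \<le> t \<and>
    (if j + 1 < M then t < a + (real j + 1) * h else t \<le> a + (real j + 1) * h)"
\<comment> \<open>The floor is the index sought except at the right endpoint, where it equals
  \<open>M\<close>; that point belongs to the last interval, which is closed on the right.\<close>
proof (cases "nat \<lfloor>(t - a) / h\<rfloor> < M")
  case True
  define j where "j = nat \<lfloor>(t - a) / h\<rfloor>"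
  have "real j \<le> (t - a) / h" "(t - a) / h < real j + 1"
    unfolding j_def using assms by (simp, linarith)
  then have "a + real j * h \<le> t" "t < a + (real j + 1) * h"
    using assms by (auto simp: field_simps)
  then show ?thesis using True by (intro exI[of _ j]) (auto simp: j_def)
next
  case False
  then have "int M \<le> \<lfloor>(t - a) / h\<rfloor>" using assms(1) by linarith
  then have "real M \<le> (t - a) / h" by (simp add: le_floor_iff)
  then have "a + M * h \<le> t" using assms by (simp add: field_simps)
  moreover have "real (M - 1) = real M - 1" using assms by simp
  ultimately show ?thesis
    using assms by (intro exI[of _ "M - 1"]) (auto simp: algebra_simps)
qed

definition grid_center :: "real ^ 'n \<Rightarrow> real \<Rightarrow> nat \<Rightarrow> ('n \<Rightarrow> nat) \<Rightarrow> real ^ 'n" where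
  "grid_center c l M j = (\<chi> i. c $ i - l / 2 + (j i + 1 / 2) * (l / M))"

text \<open>A piece that is last in some direction keeps its upper face there, so the pieces fill
  the closed cube.\<close>

definition grid_cube :: "real ^ 'n \<Rightarrow> real \<Rightarrow> nat \<Rightarrow> ('n \<Rightarrow> nat) \<Rightarrow> (real ^ 'n) set" where
  "grid_cube c l M j = half_open_cube (grid_center c l M j) (l / M) {i. j i + 1 < M}"

definition grid_indices :: "nat \<Rightarrow> ('n::finite \<Rightarrow> nat) set" where
  "grid_indices M = PiE UNIV (\<lambda>_. {..<M})"

lemma finite_grid_indices: "finite (grid_indices M)"
  unfolding grid_indices_def by (intro finite_PiE) auto

lemma mem_grid_indices_iff: "j \<in> grid_indices M \<longleftrightarrow> (\<forall>i. j i < M)"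
  by (auto simp: grid_indices_def)

lemma mem_grid_cube_iff:
  "x \<in> grid_cube c l M j \<longleftrightarrow> (\<forall>i. c $ i - l / 2 + j i * (l / M) \<le> x $ i \<and>
     (if j i + 1 < M then x $ i < c $ i - l / 2 + (real (j i) + 1) * (l / M)
      else x $ i \<le> c $ i - l / 2 + (real (j i) + 1) * (l / M)))"
proof -
  have "u + (real k + 1 / 2) * h - h / 2 = u + k * h" "u + (real k + 1 / 2) * h + h / 2 = u + (real k + 1) * h"
    for u h :: real and k :: nat by (simp_all add: algebra_simps)
  then show ?thesis
    by (simp only: grid_cube_def half_open_cube_def grid_center_def vec_lambda_beta mem_Collect_eq)
qed

lemma grid_cube_subset:
  assumes "l > 0" "j \<in> grid_indices M"
  shows "grid_cube c l M j \<subseteq> cube c l"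
proof
  fix x assume x: "x \<in> grid_cube c l M j"
  show "x \<in> cube c l"
    unfolding mem_cube_iff
  proof
    fix i
    have jM: "j i < M" using assms by (simp add: mem_grid_indices_iff)
    then have "(real (j i) + 1) * (l / M) \<le> real M * (l / M)"
      using assms by (intro mult_right_mono) auto
    moreover have "real M * (l / M) = l" "0 \<le> real (j i) * (l / M)" using jM assms by auto
    moreover have "c $ i - l / 2 + j i * (l / M) \<le> x $ i" "x $ i \<le> c $ i - l / 2 + (real (j i) + 1) * (l / M)"
      using x[unfolded mem_grid_cube_iff, rule_format, of i] by (auto split: if_splits)
    ultimately show "c $ i - l / 2 \<le> x $ i \<and> x $ i \<le> c $ i + l / 2"
      by (intro conjI) linarith+
  qed
qed

lemma grid_cube_exists:
  assumes "l > 0" "M > 0" "x \<in> cube c l"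
  shows "\<exists>j\<in>grid_indices M. x \<in> grid_cube c l M j"
proof -
  have "\<exists>k<M. c $ i - l / 2 + k * (l / M) \<le> x $ i \<and>
     (if k + 1 < M then x $ i < c $ i - l / 2 + (real k + 1) * (l / M)
      else x $ i \<le> c $ i - l / 2 + (real k + 1) * (l / M))" for i
    using assms(1,2) assms(3)[unfolded mem_cube_iff, rule_format, of i]
    by (intro grid_index_exists) auto
  then obtain j where "\<forall>i. j i < M \<and> c $ i - l / 2 + j i * (l / M) \<le> x $ i \<and>
     (if j i + 1 < M then x $ i < c $ i - l / 2 + (real (j i) + 1) * (l / M)
      else x $ i \<le> c $ i - l / 2 + (real (j i) + 1) * (l / M))"
    by metis
  then show ?thesis by (intro bexI[of _ j]) (simp_all only: mem_grid_cube_iff mem_grid_indices_iff, blast+)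
qed

text \<open>If \<open>j i < j' i\<close>, then \<open>j i\<close> is not the last index, so
  \<open>x\<close> lies strictly below the upper face of piece \<open>j\<close>, which is at or
  below the lower face of piece \<open>j'\<close>. Exchanging the roles of \<open>j\<close> and
  \<open>j'\<close> yields uniqueness.\<close>

lemma grid_cube_index_le:
  assumes "l > 0" "j' \<in> grid_indices M" "x \<in> grid_cube c l M j" "x \<in> grid_cube c l M j'"
  shows "j' i \<le> j i"
proof (rule ccontr)
  assume *: "\<not> j' i \<le> j i"
  have "j' i < M" using assms(2) by (simp add: mem_grid_indices_iff)
  then have "x $ i < c $ i - l / 2 + (real (j i) + 1) * (l / M)"
    using assms(3)[unfolded mem_grid_cube_iff, rule_format, of i] * by (simp split: if_splits)
  also have "\<dots> \<le> c $ i - l / 2 + j' i * (l / M)"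
    using * assms(1) by (intro add_left_mono mult_right_mono) auto
  also have "\<dots> \<le> x $ i"
    using assms(4)[unfolded mem_grid_cube_iff, rule_format, of i] by simp
  finally show False by simp
qed

lemma grid_cube_unique:
  assumes "l > 0" "j \<in> grid_indices M" "j' \<in> grid_indices M"
    and "x \<in> grid_cube c l M j" "x \<in> grid_cube c l M j'"
  shows "j = j'"
  using grid_cube_index_le[of l j' M x c j] grid_cube_index_le[of l j M x c j'] assms
  by (intro ext antisym) auto

lemma grid_center_mem: "l > 0 \<Longrightarrow> M > 0 \<Longrightarrow> grid_center c l M j \<in> grid_cube c l M j"
  by (auto simp: grid_cube_def half_open_cube_def)

section \<open>Size and oscillation of monomials on a cube\<close>

lemma abs_cube_coordinate_le:
  assumes "l > 0" "x \<in> cube c l"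
  shows "\<bar>(x $ i - c $ i) / l\<bar> \<le> 1"
  using assms(1) assms(2)[unfolded mem_cube_iff, rule_format, of i]
  by (auto simp: abs_le_iff field_simps)

lemma abs_cube_monomial_le:
  assumes "l > 0" "x \<in> cube c l"
  shows "\<bar>cube_monomial c l \<beta> x\<bar> \<le> 1"
  unfolding cube_monomial_def abs_prod power_abs
  using abs_cube_coordinate_le[OF assms] by (intro prod_le_1 conjI power_le_one) auto

text \<open>All factors have modulus at most 1, so a difference of products is at most the sum of
  the differences of factors. A power \<open>\<beta> i\<close> contributes at most
  \<open>\<beta> i\<close> times \<open>\<delta>\<close>, and the total degree is below
  \<open>\<kappa>\<close>.\<close>

lemma cube_monomial_diff_le:
  assumes l: "l > 0" and x: "x \<in> cube c l" and y: "y \<in> cube c l"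
    and \<beta>: "\<beta> \<in> multi_indices \<kappa>" and d: "\<And>i. \<bar>x $ i - y $ i\<bar> \<le> \<delta> * l"
  shows "\<bar>cube_monomial c l \<beta> x - cube_monomial c l \<beta> y\<bar> \<le> \<kappa> * \<delta>"
proof -
  \<comment> \<open>The sign of \<open>\<delta>\<close> is forced by \<open>d\<close>; it is used at
    the end to enlarge the degree to \<open>\<kappa>\<close>.\<close>
  have "0 \<le> \<delta> * l" using d order_trans[OF abs_ge_zero] by blast
  then have "\<delta> \<ge> 0" using l by (simp add: zero_le_mult_iff)
  let ?u = "\<lambda>i. (x $ i - c $ i) / l" and ?v = "\<lambda>i. (y $ i - c $ i) / l"
  have "\<bar>cube_monomial c l \<beta> x - cube_monomial c l \<beta> y\<bar> \<le> (\<Sum>i\<in>UNIV. norm (?u i ^ \<beta> i - ?v i ^ \<beta> i))"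
    unfolding cube_monomial_def real_norm_def[symmetric]
    using abs_cube_coordinate_le[OF l x] abs_cube_coordinate_le[OF l y]
    by (intro norm_prod_diff) (auto simp: power_abs intro!: power_le_one)
  also have "\<dots> \<le> (\<Sum>i\<in>UNIV. \<beta> i * \<delta>)"
  proof (rule sum_mono)
    fix i
    have "norm (?u i ^ \<beta> i - ?v i ^ \<beta> i) \<le> \<beta> i * norm (?u i - ?v i)"
      using abs_cube_coordinate_le[OF l x] abs_cube_coordinate_le[OF l y]
      by (intro norm_power_diff) auto
    also have "norm (?u i - ?v i) \<le> \<delta>"
      using d[of i] l by (simp add: diff_divide_distrib[symmetric] divide_le_eq)
    finally show "norm (?u i ^ \<beta> i - ?v i ^ \<beta> i) \<le> \<beta> i * \<delta>" by (simp add: mult_left_mono)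
  qed
  also have "\<dots> = real (\<Sum>i\<in>UNIV. \<beta> i) * \<delta>" by (simp add: sum_distrib_right)
  also have "\<dots> \<le> \<kappa> * \<delta>"
    using \<beta> \<open>\<delta> \<ge> 0\<close> by (intro mult_right_mono) (auto simp: multi_indices_def simp del: of_nat_sum)
  finally show ?thesis .
qed

text \<open>Two points of one piece differ by at most its side \<open>l / M\<close> in each
  coordinate, so \<open>\<delta> = 1 / M\<close>; the distance to the centre is bounded by the full
  side rather than half of it.\<close>

lemma cube_monomial_grid_diff_le:
  assumes l: "l > 0" and M: "M > 0" and j: "j \<in> grid_indices M" and \<beta>: "\<beta> \<in> multi_indices \<kappa>"
    and x: "x \<in> grid_cube c l M j"
  shows "\<bar>cube_monomial c l \<beta> x - cube_monomial c l \<beta> (grid_center c l M j)\<bar> \<le> \<kappa> / M"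
proof -
  have *: "c $ i - l / 2 + j i * (l / M) \<le> y $ i \<and> y $ i \<le> c $ i - l / 2 + (real (j i) + 1) * (l / M)"
    if "y \<in> grid_cube c l M j" for y i
    using that[unfolded mem_grid_cube_iff, rule_format, of i] by (auto split: if_splits)
  have "\<bar>cube_monomial c l \<beta> x - cube_monomial c l \<beta> (grid_center c l M j)\<bar> \<le> \<kappa> * (1 / M)"
  proof (rule cube_monomial_diff_le[OF l _ _ \<beta>])
    show "x \<in> cube c l" "grid_center c l M j \<in> cube c l"
      using grid_cube_subset[OF l j] x grid_center_mem[OF l M] by blast+
    fix i
    show "\<bar>x $ i - grid_center c l M j $ i\<bar> \<le> 1 / M * l"
      using *[OF x, of i] *[OF grid_center_mem[OF l M], of i] by (simp add: abs_le_iff algebra_simps)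
  qed
  then show ?thesis by simp
qed

section \<open>Testing on monomials\<close>

context L2_operator_cart
begin

text \<open>The coefficient of the operator norm shrinks as \<open>M\<close> grows, while that of
  \<open>F\<close> depends only on \<open>M\<close> and the dimension. The 4 is a factor 2 from
  splitting off the error \<open>d\<close> times the factor 2 lost on half-open cubes.\<close>

lemma testing_monomial:
  assumes l: "l > 0" and M: "M > 0" and \<beta>: "\<beta> \<in> multi_indices \<kappa>"
  shows "sqn \<omega> (T (\<lambda>y. of_real (indicator (cube c l) y * cube_monomial c l \<beta> y)))
    \<le> (2 * ennreal ((\<kappa> / M)\<^sup>2) * opnorm\<^sup>2 + 4 * of_nat (card (grid_indices M :: ('n \<Rightarrow> nat) set)) * F)
      * emeasure \<sigma> (cube c l)"
proof -
  define J where "J = (grid_indices M :: ('n \<Rightarrow> nat) set)"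
  define P where "P = grid_cube c l M"
  define a where "a j = cube_monomial c l \<beta> (grid_center c l M j)" for j
  define g :: "real ^ 'n \<Rightarrow> 'k" where "g y = (\<Sum>j\<in>J. of_real (a j) * of_real (indicator (P j) y))" for y
  define d :: "real ^ 'n \<Rightarrow> 'k" where
    "d y = of_real (indicator (cube c l) y * cube_monomial c l \<beta> y) - g y" for y
  have J: "finite J" by (simp add: J_def finite_grid_indices)
  have [measurable]: "P j \<in> sets borel" for j by (simp add: P_def grid_cube_def)
  have PQ: "P j \<subseteq> cube c l" if "j \<in> J" for j
    using grid_cube_subset[OF l] that by (simp add: J_def P_def)
  have uniq: "j = j'" if "j \<in> J" "j' \<in> J" "x \<in> P j" "x \<in> P j'" for j j' x
    using grid_cube_unique[OF l] that by (simp add: J_def P_def)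
  have PL: "(\<lambda>y. of_real (indicator (P j) y) :: 'k) \<in> L2_space \<sigma>" if "j \<in> J" for j
    by (rule L2_indicator[OF _ PQ[OF that]]) measurable
  have gL: "g \<in> L2_space \<sigma>"
    unfolding g_def by (intro L2_space_sum J L2_space_cmult PL)
  have d_le: "norm (d x) \<le> (\<kappa> / M) * indicator (cube c l) x" for x
  proof (cases "x \<in> cube c l")
    case True
    then obtain j where j: "j \<in> J" "x \<in> P j"
      using grid_cube_exists[OF l M] by (auto simp: J_def P_def)
    \<comment> \<open>By disjointness only the piece containing \<open>x\<close> contributes, so
      \<open>d x\<close> is the oscillation of the monomial within that piece.\<close>
    have "g x = (\<Sum>k\<in>J. if k = j then of_real (a j) else 0)"
      unfolding g_def using uniq j by (intro sum.cong) (auto simp: indicator_def)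
    then have "d x = of_real (cube_monomial c l \<beta> x - a j)"
      using True J j by (simp add: d_def)
    then show ?thesis
      using True cube_monomial_grid_diff_le[OF l M _ \<beta>] j
      by (simp only: norm_of_real) (simp add: J_def P_def a_def)
  next
    case False
    then have "g x = 0" unfolding g_def using PQ by (intro sum.neutral) (auto simp: indicator_def)
    then show ?thesis using False by (simp add: d_def)
  qed
  have "d \<in> borel_measurable borel"
    unfolding d_def g_def cube_monomial_def by measurable
  then have dL: "d \<in> L2_space \<sigma>"
    using d_le by (rule L2_cube_supported)
  have "sqn \<omega> (T (\<lambda>y. of_real (indicator (cube c l) y * cube_monomial c l \<beta> y)))
      = sqn \<omega> (T (\<lambda>y. d y + g y))"
    by (simp add: d_def)
  also have "\<dots> \<le> 2 * sqn \<omega> (T d) + 2 * sqn \<omega> (T g)"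
    by (rule sqn_T_add_le[OF dL gL])
  also have "\<dots> \<le> 2 * (opnorm\<^sup>2 * (ennreal ((\<kappa> / M)\<^sup>2) * emeasure \<sigma> (cube c l)))
      + 2 * (of_nat (card J) * (2 * F * emeasure \<sigma> (cube c l)))"
  proof (intro add_mono mult_left_mono)
    have "opnorm\<^sup>2 * sqn \<sigma> d \<le> opnorm\<^sup>2 * (ennreal ((\<kappa> / M)\<^sup>2) * emeasure \<sigma> (cube c l))"
      using d_le by (intro mult_left_mono sqn_supported_le) (auto simp: sets_eq)
    with sqn_T_le[OF dL] show "sqn \<omega> (T d) \<le> \<dots>"
      by (rule order_trans)
    have "sqn \<omega> (T g) \<le> of_nat (card J) * (\<Sum>j\<in>J. sqn \<omega> (T (\<lambda>y. of_real (indicator (P j) y))))"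
      unfolding g_def
    proof (intro sqn_T_sum_le J PL)
      fix j assume "j \<in> J"
      then have "grid_center c l M j \<in> cube c l"
        using grid_center_mem[OF l M] PQ by (auto simp: P_def)
      then show "norm (of_real (a j) :: 'k) \<le> 1"
        using abs_cube_monomial_le[OF l] by (simp add: a_def)
    qed
    also have "\<dots> \<le> of_nat (card J) * (\<Sum>j\<in>J. 2 * F * emeasure \<sigma> (P j))"
      unfolding P_def grid_cube_def using l M
      by (intro mult_left_mono sum_mono testing_half_open) auto
    \<comment> \<open>Disjointness of the pieces makes the measures add up exactly, whatever mass
      \<open>\<sigma>\<close> puts on faces.\<close>
    also have "(\<Sum>j\<in>J. 2 * F * emeasure \<sigma> (P j)) = 2 * F * emeasure \<sigma> (\<Union>j\<in>J. P j)"
    proof -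
      have "disjoint_family_on P J"
        using uniq by (fastforce simp: disjoint_family_on_def)
      then show ?thesis
        using J by (simp add: sum_distrib_left[symmetric] sum_emeasure sets_eq image_subset_iff)
    qed
    also have "of_nat (card J) * \<dots> \<le> of_nat (card J) * (2 * F * emeasure \<sigma> (cube c l))"
      using PQ by (intro mult_left_mono emeasure_mono) (auto simp: sets_eq)
    finally show "sqn \<omega> (T g) \<le> of_nat (card J) * (2 * F * emeasure \<sigma> (cube c l))" .
  qed auto
  also have "\<dots> = (2 * ennreal ((\<kappa> / M)\<^sup>2) * opnorm\<^sup>2 + 4 * of_nat (card J) * F) * emeasure \<sigma> (cube c l)"
    by (simp add: algebra_simps)
  finally show ?thesis by (simp add: J_def)
qed

end

section \<open>From the testing constant to the final estimate\<close>

lemma testing_indicator: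
  fixes \<sigma> \<omega> :: "(real ^ 'n) measure"
    and T :: "(real ^ 'n \<Rightarrow> 'k::{real_normed_field, second_countable_topology}) \<Rightarrow> real ^ 'n \<Rightarrow> 'k"
  assumes lf: "locally_finite_borel \<sigma>" and T: "bounded_L2_operator \<sigma> \<omega> T" and l: "l > 0"
  shows "sqn \<omega> (T (\<lambda>y. of_real (indicator (cube c l) y)))
    \<le> (full_testing \<sigma> \<omega> T)\<^sup>2 * emeasure \<sigma> (cube c l)"
proof -
  interpret L2_operator \<sigma> \<omega> T by standard (rule T)
  let ?f = "\<lambda>y. of_real (indicator (cube c l) y) :: 'k"
  have sets: "sets \<sigma> = sets borel" using lf by (simp add: locally_finite_borel_def)
  have fin: "emeasure \<sigma> (cube c l) < \<infinity>"
    using lf by (intro locally_finite_borel_compact) (simp_all add: cube_def)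
  show ?thesis
  \<comment> \<open>The supremum sees only cubes of positive measure. On a null cube the indicator
    has norm zero, and boundedness of \<open>T\<close> makes the left-hand side zero.\<close>
  proof (cases "emeasure \<sigma> (cube c l) = 0")
    case True
    have m: "?f \<in> borel_measurable \<sigma>"
      unfolding measurable_cong_sets[OF sets refl] by measurable
    have le: "norm (?f x) \<le> 1 * indicator (cube c l) x" for x
      by (auto simp: indicator_def)
    have "?f \<in> L2_space \<sigma>"
      using m _ fin le by (rule L2_space_supported) (simp add: sets)
    then have "sqn \<omega> (T ?f) \<le> opnorm\<^sup>2 * sqn \<sigma> ?f" by (rule sqn_T_le)
    moreover have "sqn \<sigma> ?f \<le> ennreal (1\<^sup>2) * emeasure \<sigma> (cube c l)"
      using le by (intro sqn_supported_le) (auto simp: sets)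
    ultimately show ?thesis using True by simp
  next
    case False
    have "sqn \<omega> (T ?f) / emeasure \<sigma> (cube c l) \<le> (full_testing \<sigma> \<omega> T)\<^sup>2"
      unfolding full_testing_eq ennreal_sqrt_square
      using False l by (intro SUP_upper2[of "(c, l)"]) (auto simp: sqn_def zero_less_iff_neq_zero)
    then have "sqn \<omega> (T ?f) / emeasure \<sigma> (cube c l) * emeasure \<sigma> (cube c l)
        \<le> (full_testing \<sigma> \<omega> T)\<^sup>2 * emeasure \<sigma> (cube c l)"
      by (rule mult_right_mono) simp
    then show ?thesis
      using False fin by (simp add: ennreal_divide_times ennreal_divide_self less_top)
  qed
qed

theorem theorem3:
  fixes \<kappa> :: nat and \<epsilon> :: real
  assumes "\<kappa> \<ge> 1" and "0 < \<epsilon>" and "\<epsilon> < 1"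
  shows "\<exists>C::real. C > 0 \<and>
    (\<forall>(\<sigma> :: (real ^ 'n) measure) (\<omega> :: (real ^ 'n) measure)
      (T :: (real ^ 'n \<Rightarrow> 'k::{real_normed_field, second_countable_topology}) \<Rightarrow> (real ^ 'n \<Rightarrow> 'k)).
      locally_finite_borel \<sigma> \<longrightarrow> locally_finite_borel \<omega> \<longrightarrow> bounded_L2_operator \<sigma> \<omega> T \<longrightarrow>
      full_testing_poly \<kappa> \<sigma> \<omega> T
        \<le> ennreal C * full_testing \<sigma> \<omega> T + ennreal \<epsilon> * L2_operator_norm \<sigma> \<omega> T)"
proof -
  \<comment> \<open>This choice gives \<open>\<kappa> / M \<le> \<epsilon> / 2\<close>, so that
    twice the square of \<open>\<kappa> / M\<close> stays below the square of
    \<open>\<epsilon>\<close>. It depends on \<open>\<kappa>\<close> and \<open>\<epsilon>\<close>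
    alone.\<close>
  obtain M :: nat where M: "real M > 2 * \<kappa> / \<epsilon>" using reals_Archimedean2 by blast
  have "2 * \<kappa> / \<epsilon> > 0" using assms by simp
  then have M0: "M > 0" using M by (cases M) auto
  have \<kappa>M: "\<kappa> / M \<le> \<epsilon> / 2" using M M0 assms by (simp add: field_simps)
  define K where "K = card (grid_indices M :: ('n \<Rightarrow> nat) set)"
  have "(\<lambda>_. 0) \<in> (grid_indices M :: ('n \<Rightarrow> nat) set)" using M0 by (simp add: mem_grid_indices_iff)
  then have K: "K > 0" using finite_grid_indices by (auto simp: K_def card_gt_0_iff)
  \<comment> \<open>The squared estimate has the constant \<open>4 * K\<close>; since
    \<open>K\<close> is at least 1, it is dominated by the square of \<open>2 * K\<close>, which
    becomes the constant \<open>C\<close>.\<close>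
  have K4: "4 * of_nat K \<le> (ennreal (2 * K))\<^sup>2"
  proof -
    have "real (4 * K) \<le> (2 * real K)\<^sup>2" using K by (simp add: power2_eq_square)
    then have "ennreal (real (4 * K)) \<le> ennreal ((2 * real K)\<^sup>2)" by (rule ennreal_leI)
    then show ?thesis by (simp add: ennreal_power ennreal_of_nat_eq_real_of_nat ennreal_mult)
  qed
  have \<epsilon>2: "2 * ennreal ((\<kappa> / M)\<^sup>2) \<le> (ennreal \<epsilon>)\<^sup>2"
  proof -
    have "(\<kappa> / M)\<^sup>2 \<le> (\<epsilon> / 2)\<^sup>2" using \<kappa>M by (intro power_mono) auto
    then have "2 * (\<kappa> / M)\<^sup>2 \<le> \<epsilon>\<^sup>2 / 2" by (simp add: power_divide mult.commute)
    also have "\<dots> \<le> \<epsilon>\<^sup>2" by simp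
    finally have "2 * (\<kappa> / M)\<^sup>2 \<le> \<epsilon>\<^sup>2" .
    then have "ennreal (2 * (\<kappa> / M)\<^sup>2) \<le> ennreal (\<epsilon>\<^sup>2)" by (rule ennreal_leI)
    then show ?thesis using assms by (simp add: ennreal_power ennreal_mult)
  qed
  have main: "full_testing_poly \<kappa> \<sigma> \<omega> T
      \<le> ennreal (2 * K) * full_testing \<sigma> \<omega> T + ennreal \<epsilon> * L2_operator_norm \<sigma> \<omega> T"
    if lf: "locally_finite_borel \<sigma>" and T: "bounded_L2_operator \<sigma> \<omega> T"
    for \<sigma> \<omega> :: "(real ^ 'n) measure" and T :: "(real ^ 'n \<Rightarrow> 'k) \<Rightarrow> real ^ 'n \<Rightarrow> 'k"
  \<comment> \<open>An infinite testing constant makes the right-hand side infinite because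
    \<open>K > 0\<close>. Otherwise its square is a legitimate finite \<open>F\<close>.\<close>
  proof (cases "full_testing \<sigma> \<omega> T = \<infinity>")
    case True
    then show ?thesis using K by (simp add: ennreal_mult_top)
  next
    case False
    let ?F = "full_testing \<sigma> \<omega> T" and ?N = "L2_operator_norm \<sigma> \<omega> T"
    interpret L2_operator_cart \<sigma> \<omega> T "?F\<^sup>2"
      using lf T False testing_indicator[OF lf T]
      by unfold_locales (auto simp: power2_eq_square ennreal_mult_less_top less_top)
    have bound: "sqn \<omega> (T (\<lambda>y. of_real (indicator (cube c l) y * cube_monomial c l \<beta> y)))
        / emeasure \<sigma> (cube c l) \<le> (ennreal (2 * K) * ?F + ennreal \<epsilon> * ?N)\<^sup>2"
      if l: "l > 0" and pos: "emeasure \<sigma> (cube c l) > 0" and \<beta>: "\<beta> \<in> multi_indices \<kappa>" for c l \<beta>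
    proof -
      have "sqn \<omega> (T (\<lambda>y. of_real (indicator (cube c l) y * cube_monomial c l \<beta> y)))
        \<le> (2 * ennreal ((\<kappa> / M)\<^sup>2) * ?N\<^sup>2 + 4 * of_nat K * ?F\<^sup>2) * emeasure \<sigma> (cube c l)"
        unfolding K_def by (rule testing_monomial[OF l M0 \<beta>])
      also have "\<dots> \<le> ((ennreal \<epsilon>)\<^sup>2 * ?N\<^sup>2 + (ennreal (2 * K))\<^sup>2 * ?F\<^sup>2) * emeasure \<sigma> (cube c l)"
        by (intro mult_right_mono add_mono K4 \<epsilon>2) auto
      also have "\<dots> \<le> (ennreal (2 * K) * ?F + ennreal \<epsilon> * ?N)\<^sup>2 * emeasure \<sigma> (cube c l)"
        using square_add_le[of "ennreal (2 * K) * ?F" "ennreal \<epsilon> * ?N"]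
        by (intro mult_right_mono) (simp_all add: power_mult_distrib add.commute)
      finally show ?thesis
        using pos by (intro divide_le_posI_ennreal) (auto simp: mult.commute)
    qed
    \<comment> \<open>The maximum is characterized by its elements only over a nonempty set;
      \<open>\<kappa> \<ge> 1\<close> provides the zero multi-index.\<close>
    have "(\<lambda>_. 0) \<in> (multi_indices \<kappa> :: ('n \<Rightarrow> nat) set)"
      using assms(1) by (simp add: multi_indices_def)
    then have ne: "(multi_indices \<kappa> :: ('n \<Rightarrow> nat) set) \<noteq> {}" by blast
    show ?thesis
      unfolding full_testing_poly_def
    proof (intro ennreal_sqrt_le SUP_least, clarify)
      fix c :: "real ^ 'n" and l :: real
      assume "l > 0" "emeasure \<sigma> (cube c l) > 0"
      then show "(MAX \<beta>\<in>multi_indices \<kappa>.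
          (\<integral>\<^sup>+ x. ennreal ((norm
             (T (\<lambda>y. of_real (indicator (cube c l) y * cube_monomial c l \<beta> y)) x))\<^sup>2) \<partial>\<omega>)
          / emeasure \<sigma> (cube c l)) \<le> (ennreal (2 * K) * ?F + ennreal \<epsilon> * ?N)\<^sup>2"
        using bound[unfolded sqn_def] ne finite_multi_indices[where 'n = 'n]
        by (subst Max_le_iff) auto
    qed
  qed
  show ?thesis
    by (rule exI[of _ "real (2 * K)"]) (use main K in simp)
qed

end
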